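(* Let $x, \bar{x}, q \in \mathbb{R}^d$ be nonzero vectors with $\Vert \bar{x} \Vert = \Vert x \Vert$. Let $\alpha$ be the angle between $x$ and $\bar{x}$, and assume $\alpha \in (0, \pi/2)$. Let $\beta$ be the angle between $\bar{x}$ and $q$, and assume $\beta \in (0, \pi/2)$. Let $t$ be the angle between the two planes defined by $(x, \bar{x})$ and $(\bar{x}, q)$ (the dihedral angle along $\bar{x}$, as defined in the context). If $$\frac{\cos(\beta)}{\sin(\alpha)\sin(\beta)}\left[\frac{1}{2-\cos(\alpha)}-\cos(\alpha)\right]\leq\cos(t)\leq\frac{\cos(\beta)}{\sin(\alpha)\sin(\beta)}\left[\frac{1}{\cos(\alpha)}-\cos(\alpha)\right],$$ then $$\left\vert \frac{q^{\top}x - q^{\top}\bar{x}}{q^{\top}x} \right\vert \le 1-\frac{x^{\top}\bar{x}}{\Vert x\Vert \Vert \bar{x} \Vert}.$$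
   Context: $\Vert\cdot\Vert$ is the Euclidean norm on $\mathbb{R}^d$, and the angle between nonzero vectors $u,v$ is the number in $[0,\pi]$ whose cosine is $u^{\top}v/(\Vert u\Vert\Vert v\Vert)$. Here $x$ is a data item, $q$ a query, and $\bar{x}$ an approximation of $x$ that is exact in norm ($\Vert\bar{x}\Vert=\Vert x\Vert$) but inexact in direction. The quantity $\left\vert (q^{\top}x - q^{\top}\bar{x})/(q^{\top}x) \right\vert$ is called the inner product error, and $1-x^{\top}\bar{x}/(\Vert x\Vert \Vert \bar{x} \Vert)$ is called the angular error. The angle $t\in[0,\pi]$ between the planes defined by $(x,\bar{x})$ and $(\bar{x},q)$ is the dihedral angle along the line spanned by $\bar{x}$: it is the angle between the components of $x$ and of $q$ orthogonal to $\bar{x}$, i.e. between $x-\frac{x^{\top}\bar{x}}{\Vert\bar{x}\Vert^2}\bar{x}$ and $q-\frac{q^{\top}\bar{x}}{\Vert\bar{x}\Vert^2}\bar{x}$ (both nonzero since $\alpha,\beta\in(0,\pi/2)$). *)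

theory Defs
  imports "HOL-Analysis.Analysis"
begin

(* Only meaningful for nonzero u and v: there the quotient lies in [-1, 1] by Cauchy-Schwarz, and
   arccos picks the unique number in [0, pi] with that cosine. *)
definition vec_angle :: "real ^ 'd \<Rightarrow> real ^ 'd \<Rightarrow> real" where
  "vec_angle u v = arccos ((u \<bullet> v) / (norm u * norm v))"

definition orth_component :: "real ^ 'd \<Rightarrow> real ^ 'd \<Rightarrow> real ^ 'd" where
  "orth_component w u = u - ((u \<bullet> w) / (norm w)\<^sup>2) *\<^sub>R w"

(* Angle between the planes spanned by (u, w) and (w, v), with values in [0, pi]: each plane is
   represented by the half-plane bounded by the line of w that contains u, respectively v. *)
definition dihedral_angle :: "real ^ 'd \<Rightarrow> real ^ 'd \<Rightarrow> real ^ 'd \<Rightarrow> real" where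
  "dihedral_angle u w v = vec_angle (orth_component w u) (orth_component w v)"

definition inner_product_error :: "real ^ 'd \<Rightarrow> real ^ 'd \<Rightarrow> real ^ 'd \<Rightarrow> real" where
  "inner_product_error q x xbar = \<bar>(q \<bullet> x - q \<bullet> xbar) / (q \<bullet> x)\<bar>"

definition angular_error :: "real ^ 'd \<Rightarrow> real ^ 'd \<Rightarrow> real" where
  "angular_error x xbar = 1 - (x \<bullet> xbar) / (norm x * norm xbar)"

end

theory Submission
  imports Defs
begin

text \<open>
  By the spherical law of cosines, the ratio of \<open>q \<bullet> x\<close> to \<open>q \<bullet> xbar\<close> is
  \<open>r = cos \<alpha> + sin \<alpha> * sin \<beta> * cos t / cos \<beta>\<close>, so the two bounds on \<open>cos t\<close> say exactly that
  \<open>1 / r\<close> lies in \<open>[cos \<alpha>, 2 - cos \<alpha>]\<close>, i.e. within \<open>1 - cos \<alpha>\<close> of \<open>1\<close>.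
\<close>

lemma vec_angle_commute: "vec_angle u v = vec_angle v u"
  by (simp add: vec_angle_def inner_commute mult.commute)

text \<open>Cauchy-Schwarz; for a zero vector the quotient is 0 because division by zero yields 0,
  so no nonzeroness hypothesis is carried along.\<close>

lemma vec_angle_quotient_bounded: "\<bar>(u \<bullet> v) / (norm u * norm v)\<bar> \<le> 1"
  using Cauchy_Schwarz_ineq2[of u v]
  by (cases "u = 0 \<or> v = 0") (auto simp: abs_mult)

text \<open>With a zero vector both sides vanish. Hence this applies to orthogonal components
  without first showing that they are nonzero.\<close>

lemma inner_eq_cos_vec_angle: "u \<bullet> v = norm u * norm v * cos (vec_angle u v)"
  using vec_angle_quotient_bounded[of u v]
  by (cases "u = 0 \<or> v = 0") (auto simp: vec_angle_def cos_arccos_abs)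

lemma sin_vec_angle_nonneg: "0 \<le> sin (vec_angle u v)"
  using vec_angle_quotient_bounded[of u v] arccos[of "(u \<bullet> v) / (norm u * norm v)"]
  unfolding vec_angle_def abs_le_iff by (intro sin_ge_zero) auto

lemma inner_orth_component:
  assumes "w \<noteq> 0"
  shows "orth_component w u \<bullet> orth_component w v = u \<bullet> v - (u \<bullet> w) * (v \<bullet> w) / (norm w)\<^sup>2"
  using assms
  by (simp add: orth_component_def inner_diff_left inner_diff_right inner_commute[of w]
      power2_norm_eq_inner[symmetric])

text \<open>Pythagoras: removing the component along \<open>w\<close> leaves the factor 1 - cos^2 =
  sin^2. Both sides are nonnegative, so comparing squares suffices.\<close>

lemma norm_orth_component:
  assumes "w \<noteq> 0"
  shows "norm (orth_component w u) = norm u * sin (vec_angle u w)"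
proof (rule power2_eq_imp_eq)
  have "(norm (orth_component w u))\<^sup>2 = (norm u)\<^sup>2 - (u \<bullet> w)\<^sup>2 / (norm w)\<^sup>2"
    using inner_orth_component[OF assms, of u u]
    by (simp add: power2_norm_eq_inner power2_eq_square[of "u \<bullet> w"])
  also have "\<dots> = (norm u)\<^sup>2 * (1 - (cos (vec_angle u w))\<^sup>2)"
    using assms by (simp add: inner_eq_cos_vec_angle[of u w] power_mult_distrib algebra_simps)
  finally show "(norm (orth_component w u))\<^sup>2 = (norm u * sin (vec_angle u w))\<^sup>2"
    by (simp add: sin_squared_eq power_mult_distrib)
qed (simp_all add: sin_vec_angle_nonneg)

text \<open>Split \<open>u\<close> and \<open>v\<close> along \<open>w\<close> and orthogonally to
  it; the mixed terms vanish. The parallel parts give the product of cosines, the orthogonal parts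
  the term with the dihedral angle.\<close>

lemma spherical_law_of_cosines:
  assumes "w \<noteq> 0"
  shows "u \<bullet> v = norm u * norm v *
    (cos (vec_angle u w) * cos (vec_angle w v) +
     sin (vec_angle u w) * sin (vec_angle w v) * cos (dihedral_angle u w v))"
proof -
  have "u \<bullet> v = (u \<bullet> w) * (v \<bullet> w) / (norm w)\<^sup>2 + orth_component w u \<bullet> orth_component w v"
    by (simp add: inner_orth_component[OF assms])
  also have "(u \<bullet> w) * (v \<bullet> w) / (norm w)\<^sup>2 =
      norm u * norm v * (cos (vec_angle u w) * cos (vec_angle w v))"
    using assms
    by (simp add: inner_eq_cos_vec_angle[of _ w] vec_angle_commute[of v] power2_eq_square)
  also have "orth_component w u \<bullet> orth_component w v =
      norm u * norm v *
      (sin (vec_angle u w) * sin (vec_angle w v) * cos (dihedral_angle u w v))"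
    by (simp add: inner_eq_cos_vec_angle[of "orth_component w u"] norm_orth_component[OF assms]
        dihedral_angle_def vec_angle_commute[of v])
  finally show ?thesis
    by (simp add: algebra_simps)
qed

lemma relative_error_le:
  fixes a p s :: real
  assumes "0 < a" "a < 1" "0 < s" "s / (2 - a) \<le> p" "p \<le> s / a"
  shows "\<bar>(p - s) / p\<bar> \<le> 1 - a"
proof -
  have "0 < s / (2 - a)" using assms by simp
  then have "0 < p" using assms by linarith
  then have "\<bar>(p - s) / p\<bar> = \<bar>p - s\<bar> / p" by (simp add: abs_divide)
  \<comment> \<open>Subtracting \<open>p\<close> from the first inequality bounds
    \<open>s - p\<close>, and rearranging the second bounds \<open>p - s\<close>, both by
    \<open>(1 - a) * p\<close>.\<close>
  moreover have "s \<le> p * (2 - a)" "p * a \<le> s"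
    using assms by (simp_all add: field_simps)
  then have "\<bar>p - s\<bar> \<le> (1 - a) * p" by (simp add: abs_le_iff algebra_simps)
  ultimately show ?thesis using \<open>0 < p\<close> by (simp add: divide_le_eq)
qed

theorem theorem1:
  fixes x xbar q :: "real ^ 'd" and \<alpha> \<beta> t :: real
  assumes "x \<noteq> 0" and "xbar \<noteq> 0" and "q \<noteq> 0"
    and "norm xbar = norm x"
    and "\<alpha> = vec_angle x xbar" and "\<alpha> \<in> {0<..<pi/2}"
    and "\<beta> = vec_angle xbar q" and "\<beta> \<in> {0<..<pi/2}"
    and "t = dihedral_angle x xbar q"
    and "cos \<beta> / (sin \<alpha> * sin \<beta>) * (1 / (2 - cos \<alpha>) - cos \<alpha>) \<le> cos t"
    and "cos t \<le> cos \<beta> / (sin \<alpha> * sin \<beta>) * (1 / cos \<alpha> - cos \<alpha>)"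
  shows "inner_product_error q x xbar \<le> angular_error x xbar"
proof -
  \<comment> \<open>As \<open>xbar\<close> has the norm of \<open>x\<close>, this factor is common
    to \<open>q \<bullet> x\<close> and \<open>q \<bullet> xbar\<close> and cancels in the relative
    error.\<close>
  define N where "N = norm q * norm x"
  have pos: "0 < N" "0 < cos \<alpha>" "0 < cos \<beta>" "0 < sin \<alpha>" "0 < sin \<beta>"
    using assms(1,3,6,8) by (auto simp: N_def cos_gt_zero_pi intro!: sin_gt_zero)
  have "\<alpha> \<in> {0<..<pi/2}" by (rule assms)
  then have "cos \<alpha> < cos 0" by (intro cos_monotone_0_pi) auto
  then have lt1: "cos \<alpha> < 1" by simp
  define c where "c = cos \<alpha> * cos \<beta> + sin \<alpha> * sin \<beta> * cos t"
  have qx: "q \<bullet> x = N * c"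
    using spherical_law_of_cosines[OF assms(2), of x q] assms(5,7,9)
    by (simp add: inner_commute N_def c_def mult.commute)
  have qxbar: "q \<bullet> xbar = N * cos \<beta>"
    using inner_eq_cos_vec_angle[of xbar q] assms(4,7)
    by (simp add: inner_commute N_def mult.commute)
  have bounds: "cos \<beta> / (2 - cos \<alpha>) \<le> c" "c \<le> cos \<beta> / cos \<alpha>"
  proof -
    \<comment> \<open>Clear the positive factor \<open>sin \<alpha> * sin \<beta>\<close>; adding
      \<open>cos \<alpha> * cos \<beta>\<close> then cancels the subtracted term in the bracket and
      leaves a bound on \<open>c\<close>.\<close>
    have "cos \<beta> * (1 / (2 - cos \<alpha>) - cos \<alpha>) \<le> cos t * (sin \<alpha> * sin \<beta>)"
      using assms(10) pos by (simp add: pos_divide_le_eq)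
    then show "cos \<beta> / (2 - cos \<alpha>) \<le> c"
      by (simp add: c_def algebra_simps)
    have "cos t * (sin \<alpha> * sin \<beta>) \<le> cos \<beta> * (1 / cos \<alpha> - cos \<alpha>)"
      using assms(11) pos by (simp add: pos_le_divide_eq)
    then show "c \<le> cos \<beta> / cos \<alpha>"
      by (simp add: c_def algebra_simps)
  qed
  have "inner_product_error q x xbar = \<bar>(c - cos \<beta>) / c\<bar>"
    using pos(1) by (simp add: inner_product_error_def qx qxbar flip: right_diff_distrib)
  also have "\<dots> \<le> 1 - cos \<alpha>"
    using relative_error_le[OF pos(2) lt1 pos(3) bounds] .
  also have "\<dots> = angular_error x xbar"
    using assms(1,2) inner_eq_cos_vec_angle[of x xbar] assms(5) by (simp add: angular_error_def)
  finally show ?thesis .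
qed

end
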